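(* For $\mathbf{e}:=(\hat{\varepsilon}_X)_{X}$, where $X$ runs over all finite sets, we have $\Phi_1(\mathfrak{B})=\mathfrak{PB}_{\mathbf{e}}$; that is, for all finite sets $X,Y$, $$\Phi_1(\mathfrak{B}(X,Y))=\hat{\varepsilon}_Y\circ\mathfrak{PB}(X,Y)\circ\hat{\varepsilon}_X .$$
   Context: For finite sets $X,Y$, a partitioned binary relation (PBR) on $(X,Y)$ is a binary relation $\alpha\subseteq (X\coprod Y)^2$ on the disjoint union $X\coprod Y$; $X$ is its domain and $Y$ its codomain; pairs $(a,b)\in\alpha$ are edges. If $X$ and $Y$ overlap, $a^{(d)}$ and $a^{(c)}$ denote $a$ seen in the domain, respectively codomain. Composition: for $\alpha$ a PBR on $(X,Y)$ and $\beta$ a PBR on $(Y,Z)$, an $(\alpha,\beta)$-connected sequence is a finite nonempty sequence $(a_1,b_1),\dots,(a_m,b_m)$ of edges, each taken from $\alpha$ or from $\beta$ and regarded as pairs of elements of $X\coprod Y\coprod Z$, such that no two successive edges are taken from the same PBR and $b_i=a_{i+1}$ for $i=1,\dots,m-1$; it connects $a_1$ to $b_m$. $\beta\circ\alpha$ is the PBR on $(X,Z)$ such that, for $a,b\in X\coprod Z$, $(a,b)\in\beta\circ\alpha$ iff some $(\alpha,\beta)$-connected sequence connects $a$ to $b$. Finite sets, with the sets $\mathfrak{PB}(X,Y)$ of all PBRs on $(X,Y)$ as morphisms and $\circ$ as composition, form a category $\mathfrak{PB}$. $\mathfrak{B}$ is the category of binary relations: objects are finite sets, $\mathfrak{B}(X,Y)$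 is the set of all subsets of $X\times Y$, with the usual composition of relations (boolean matrix multiplication). $\Phi_1$ is the inclusion $\mathfrak{B}(X,Y)\subset\mathfrak{PB}(X,Y)$ viewing a relation $\theta\subseteq X\times Y$ as the PBR on $(X,Y)$ with edges $(x,y)$, $(x,y)\in\theta$, where $x$ is in the domain and $y$ in the codomain (it is the identity on objects). $\hat{\varepsilon}_X$ is the idempotent PBR on $(X,X)$ consisting exactly of the edges $(x^{(d)},x^{(c)})$, $x\in X$. For a category $\mathcal{C}$ and a collection $\mathbf{e}=(e_X)_{X\in\mathcal{C}}$ of idempotents $e_X\in\mathcal{C}(X,X)$, an $\mathbf{e}$-subcategory of $\mathcal{C}$ is a category $\mathcal{D}$ whose objects form a subclass of those of $\mathcal{C}$, with $\mathcal{D}(X,Y)\subset\mathcal{C}(X,Y)$, composition restricted from $\mathcal{C}$, and $e_X$ as identity morphism of $X$. $\mathcal{C}_{\mathbf{e}}$ is the unique maximum $\mathbf{e}$-subcategory; it has the same objects as $\mathcal{C}$, and $\mathcal{C}_{\mathbf{e}}(X,Y)=e_Y\,\mathcal{C}(X,Y)\,e_X$. *)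

theory Defs
  imports Main
begin

section \<open>Partitioned binary relations\<close>

text \<open>
  The disjoint union of \<open>X\<close> and \<open>Y\<close> is \<open>X <+> Y\<close>; for \<open>X\<close> the domain and \<open>Y\<close> the codomain,
  \<open>Inl a\<close> is \<open>a\<close> seen in the domain and \<open>Inr a\<close> is \<open>a\<close> seen in the codomain.
\<close>

type_synonym ('x, 'y) pbr = "('x + 'y) rel"

definition PBR :: "'x set \<Rightarrow> 'y set \<Rightarrow> ('x, 'y) pbr set" where
  "PBR X Y = Pow ((X <+> Y) \<times> (X <+> Y))"

text \<open>
  The embeddings of the pairwise disjoint unions into the threefold disjoint union
  (\<open>Inr\<close> is the embedding of the second and third summands).
\<close>

definition emb12 :: "'x + 'y \<Rightarrow> 'x + 'y + 'z" where
  "emb12 = case_sum Inl (Inr \<circ> Inl)"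

definition emb13 :: "'x + 'z \<Rightarrow> 'x + 'y + 'z" where
  "emb13 = case_sum Inl (Inr \<circ> Inr)"

text \<open>
  The entries of a connected sequence are elements of \<open>\<alpha> <+> \<beta>\<close>, so that each entry records
  from which of the two relations it is taken. This matters for edges between middle elements,
  which can belong to both.
\<close>

type_synonym ('x, 'y, 'z) step = "('x + 'y) \<times> ('x + 'y) + ('y + 'z) \<times> ('y + 'z)"

definition step_src :: "('x, 'y, 'z) step \<Rightarrow> 'x + 'y + 'z" where
  "step_src = case_sum (\<lambda>(p, q). emb12 p) (\<lambda>(p, q). Inr p)"

definition step_tgt :: "('x, 'y, 'z) step \<Rightarrow> 'x + 'y + 'z" where
  "step_tgt = case_sum (\<lambda>(p, q). emb12 q) (\<lambda>(p, q). Inr q)"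

definition connected_seq ::
    "('x, 'y) pbr \<Rightarrow> ('y, 'z) pbr \<Rightarrow> ('x, 'y, 'z) step list \<Rightarrow> bool" where
  "connected_seq \<alpha> \<beta> s \<longleftrightarrow> s \<noteq> [] \<and> set s \<subseteq> \<alpha> <+> \<beta> \<and>
     (\<forall>i. Suc i < length s \<longrightarrow>
        isl (s ! i) \<noteq> isl (s ! Suc i) \<and> step_tgt (s ! i) = step_src (s ! Suc i))"

definition connects :: "('x, 'y, 'z) step list \<Rightarrow> 'x + 'y + 'z \<Rightarrow> 'x + 'y + 'z \<Rightarrow> bool" where
  "connects s a b \<longleftrightarrow> step_src (hd s) = a \<and> step_tgt (last s) = b"

text \<open>
  For \<open>\<alpha> \<in> PBR X Y\<close> and \<open>\<beta> \<in> PBR Y Z\<close> the endpoints \<open>a, b\<close> below lie in \<open>X <+> Z\<close> automatically.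
\<close>

definition pbr_comp :: "('y, 'z) pbr \<Rightarrow> ('x, 'y) pbr \<Rightarrow> ('x, 'z) pbr"  (infixl \<open>\<circ>\<^sub>P\<close> 75) where
  "\<beta> \<circ>\<^sub>P \<alpha> = {(a, b). \<exists>s. connected_seq \<alpha> \<beta> s \<and> connects s (emb13 a) (emb13 b)}"

definition pbr_id :: "'x set \<Rightarrow> ('x, 'x) pbr" where
  "pbr_id X = (\<lambda>x. (Inl x, Inr x)) ` X \<union> (\<lambda>x. (Inr x, Inl x)) ` X"

definition eps_hat :: "'x set \<Rightarrow> ('x, 'x) pbr" where
  "eps_hat X = {(Inl x, Inr x) |x. x \<in> X}"

definition Phi1 :: "('x \<times> 'y) set \<Rightarrow> ('x, 'y) pbr" where
  "Phi1 \<theta> = {(Inl x, Inr y) |x y. (x, y) \<in> \<theta>}"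


section \<open>Categories and their \<open>e\<close>-subcategories\<close>

text \<open>
  \<open>Cmp C g f\<close> is \<open>g\<close> after \<open>f\<close>. Hom-sets need not be disjoint: a morphism is an element together
  with a choice of domain and codomain.
\<close>

record ('o, 'm) cat =
  Obj :: "'o set"
  Hom :: "'o \<Rightarrow> 'o \<Rightarrow> 'm set"
  Cmp :: "'m \<Rightarrow> 'm \<Rightarrow> 'm"
  Idt :: "'o \<Rightarrow> 'm"

locale category =
  fixes C :: "('o, 'm) cat" (structure)
  assumes Idt_closed: "X \<in> Obj C \<Longrightarrow> Idt C X \<in> Hom C X X"
    and Cmp_closed: "\<lbrakk>X \<in> Obj C; Y \<in> Obj C; Z \<in> Obj C; f \<in> Hom C X Y; g \<in> Hom C Y Z\<rbrakk>
      \<Longrightarrow> Cmp C g f \<in> Hom C X Z"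
    and Idt_left: "\<lbrakk>X \<in> Obj C; Y \<in> Obj C; f \<in> Hom C X Y\<rbrakk> \<Longrightarrow> Cmp C (Idt C Y) f = f"
    and Idt_right: "\<lbrakk>X \<in> Obj C; Y \<in> Obj C; f \<in> Hom C X Y\<rbrakk> \<Longrightarrow> Cmp C f (Idt C X) = f"
    and Cmp_assoc: "\<lbrakk>W \<in> Obj C; X \<in> Obj C; Y \<in> Obj C; Z \<in> Obj C;
        f \<in> Hom C W X; g \<in> Hom C X Y; h \<in> Hom C Y Z\<rbrakk>
      \<Longrightarrow> Cmp C h (Cmp C g f) = Cmp C (Cmp C h g) f"

definition e_subcategory :: "('o, 'm) cat \<Rightarrow> ('o \<Rightarrow> 'm) \<Rightarrow> ('o, 'm) cat \<Rightarrow> bool" where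
  "e_subcategory C e D \<longleftrightarrow> category D \<and> Obj D \<subseteq> Obj C \<and>
     (\<forall>X\<in>Obj D. \<forall>Y\<in>Obj D. Hom D X Y \<subseteq> Hom C X Y) \<and>
     (\<forall>X\<in>Obj D. \<forall>Y\<in>Obj D. \<forall>Z\<in>Obj D. \<forall>f\<in>Hom D X Y. \<forall>g\<in>Hom D Y Z. Cmp D g f = Cmp C g f) \<and>
     (\<forall>X\<in>Obj D. Idt D X = e X)"

text \<open>
  A maximum \<open>e\<close>-subcategory is determined uniquely: its objects and the hom-sets between them
  by the inclusions below, its composition and identities by \<open>C\<close> and \<open>e\<close>.
\<close>

definition maximum_e_subcategory :: "('o, 'm) cat \<Rightarrow> ('o \<Rightarrow> 'm) \<Rightarrow> ('o, 'm) cat \<Rightarrow> bool" where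
  "maximum_e_subcategory C e D \<longleftrightarrow> e_subcategory C e D \<and>
     (\<forall>D'. e_subcategory C e D' \<longrightarrow>
        Obj D' \<subseteq> Obj D \<and> (\<forall>X\<in>Obj D'. \<forall>Y\<in>Obj D'. Hom D' X Y \<subseteq> Hom D X Y))"


section \<open>The categories of relations and of partitioned binary relations\<close>

text \<open>The objects are the finite sets with elements in an arbitrary type \<open>'a\<close>.\<close>

definition PB_cat :: "('a set, ('a, 'a) pbr) cat" where
  "PB_cat = \<lparr>Obj = {X. finite X}, Hom = PBR, Cmp = (\<circ>\<^sub>P), Idt = pbr_id\<rparr>"

definition B_cat :: "('a set, ('a \<times> 'a) set) cat" where
  "B_cat = \<lparr>Obj = {X. finite X}, Hom = (\<lambda>X Y. Pow (X \<times> Y)), Cmp = (\<lambda>\<psi> \<theta>. \<theta> O \<psi>), Idt = Id_on\<rparr>"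

text \<open>The image in \<open>PB_cat\<close> of the functor \<open>Phi1\<close>, which is the identity on objects.\<close>

definition Phi1_B_cat :: "('a set, ('a, 'a) pbr) cat" where
  "Phi1_B_cat = \<lparr>Obj = Obj B_cat, Hom = (\<lambda>X Y. Phi1 ` Hom B_cat X Y),
     Cmp = Cmp PB_cat, Idt = (\<lambda>X. Phi1 (Idt B_cat X))\<rparr>"

end

theory Submission imports Defs
begin

text \<open>
  Every edge of \<open>Phi1 \<theta>\<close> runs from the domain to the codomain. Hence, when one of two composed
  relations is of this form, a connected sequence that has crossed the middle set from the first
  relation into the second cannot come back, and it has at most two edges. Composition is then
  explicit (\<open>pbr_comp_no_return\<close>): an edge from the domain to the codomain of the composite is
  an edge to the middle followed by an edge from the middle, and the only other edges are those of
  the first relation within its domain and those of the second within its codomain.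

  Two consequences give the result. Composition with \<open>Phi1 (Id_on Y)\<close>, which is \<open>eps_hat Y\<close>, on
  the left removes the edges that start in the codomain, and with \<open>eps_hat X\<close> on the right those
  that end in the domain, so the two together keep exactly the edges from domain to codomain
  (\<open>eps_hat_sandwich\<close>): these relations are the image of \<open>Phi1\<close>. Secondly, \<open>Phi1\<close> turns composition
  of relations into composition of partitioned binary relations and \<open>Id_on X\<close> into \<open>eps_hat X\<close>, so its
  image is a category with identities \<open>eps_hat X\<close>. It is the maximum one because a morphism
  \<open>f\<close> of any \<open>e\<close>-subcategory equals \<open>e\<^sub>Y f e\<^sub>X\<close>.
\<close>

text \<open>
  Among any three steps that alternate between the relations, a step from \<open>\<beta>\<close> is followed by one
  from \<open>\<alpha>\<close>. The two would have to meet in a middle element, which \<open>no_return\<close> excludes.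
\<close>

lemma connected_seq_no_return [consumes 2]:
  assumes s: "connected_seq \<alpha> \<beta> s"
    and no_return: "\<forall>p q y. (p, Inl y) \<in> \<beta> \<longrightarrow> (Inr y, q) \<notin> \<alpha>"
  obtains (first) e where "e \<in> \<alpha>" "s = [Inl e]"
    | (second) f where "f \<in> \<beta>" "s = [Inr f]"
    | (both) e f where "e \<in> \<alpha>" "f \<in> \<beta>" "s = [Inl e, Inr f]"
proof -
  have no_step: False
    if uv: "u \<in> \<alpha> <+> \<beta>" "v \<in> \<alpha> <+> \<beta>" "\<not> isl u" "isl v" "step_tgt u = step_src v" for u v
    using uv no_return
    by (auto simp: step_tgt_def step_src_def emb12_def split: sum.splits)
  have steps: "set s \<subseteq> \<alpha> <+> \<beta>"
    and succ: "\<And>i. Suc i < length s \<Longrightarrow>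
      isl (s ! i) \<noteq> isl (s ! Suc i) \<and> step_tgt (s ! i) = step_src (s ! Suc i)"
    using s by (auto simp: connected_seq_def)
  from s consider (1) u where "s = [u]" | (2) u v where "s = [u, v]"
    | (3) u v w r where "s = u # v # w # r"
    by (metis connected_seq_def neq_Nil_conv)
  then show thesis
  proof cases
    case 1
    then show thesis using steps first second by auto
  next
    case 2
    then show thesis using steps succ[of 0] no_step[of u v] both by auto
  next
    case 3
    then show thesis
      using steps succ[of 0] succ[of 1] no_step[of u v] no_step[of v w] by auto
  qed
qed

lemma pbr_comp_no_return:
  assumes no_return: "\<forall>p q y. (p, Inl y) \<in> \<beta> \<longrightarrow> (Inr y, q) \<notin> \<alpha>"
  shows "\<beta> \<circ>\<^sub>P \<alpha> = {(Inl x, Inl x') |x x'. (Inl x, Inl x') \<in> \<alpha>}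
    \<union> {(Inr z, Inr z') |z z'. (Inr z, Inr z') \<in> \<beta>}
    \<union> {(Inl x, Inr z) |x z. \<exists>y. (Inl x, Inr y) \<in> \<alpha> \<and> (Inl y, Inr z) \<in> \<beta>}"
    (is "_ = ?R")
proof (intro equalityI subrelI)
  fix a b assume "(a, b) \<in> \<beta> \<circ>\<^sub>P \<alpha>"
  then obtain s where s: "connected_seq \<alpha> \<beta> s" and c: "connects s (emb13 a) (emb13 b)"
    by (auto simp: pbr_comp_def)
  from s no_return show "(a, b) \<in> ?R"
  proof (cases rule: connected_seq_no_return)
    case (first e)
    then show ?thesis using c
      by (cases e) (auto simp: connects_def step_src_def step_tgt_def emb12_def emb13_def
          split: sum.splits)
  next
    case (second f)
    then show ?thesis using c
      by (cases f) (auto simp: connects_def step_src_def step_tgt_def emb13_def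
          split: sum.splits)
  next
    case (both e f)
    then have "step_tgt (Inl e) = step_src (Inr f)"
      using s by (auto simp: connected_seq_def)
    then show ?thesis using both c
      by (cases e; cases f) (auto simp: connects_def step_src_def step_tgt_def emb12_def emb13_def
          split: sum.splits)
  qed
next
  fix a b assume "(a, b) \<in> ?R"
  then consider
      (first) x x' where "a = Inl x" "b = Inl x'" "(Inl x, Inl x') \<in> \<alpha>"
    | (second) z z' where "a = Inr z" "b = Inr z'" "(Inr z, Inr z') \<in> \<beta>"
    | (both) x y z where "a = Inl x" "b = Inr z" "(Inl x, Inr y) \<in> \<alpha>" "(Inl y, Inr z) \<in> \<beta>"
    by blast
  then show "(a, b) \<in> \<beta> \<circ>\<^sub>P \<alpha>"
  proof cases
    case first
    then show ?thesis
      by (auto simp: pbr_comp_def connected_seq_def connects_def step_src_def step_tgt_def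
          emb12_def emb13_def intro!: exI[of _ "[Inl (Inl x, Inl x')]"])
  next
    case second
    then show ?thesis
      by (auto simp: pbr_comp_def connected_seq_def connects_def step_src_def step_tgt_def
          emb12_def emb13_def intro!: exI[of _ "[Inr (Inr z, Inr z')]"])
  next
    case both
    then show ?thesis
      by (auto simp: pbr_comp_def connected_seq_def connects_def step_src_def step_tgt_def
          emb12_def emb13_def intro!: exI[of _ "[Inl (Inl x, Inr y), Inr (Inl y, Inr z)]"])
  qed
qed

lemma pbr_comp_Phi1_right:
  "\<beta> \<circ>\<^sub>P Phi1 \<theta> = {(Inr z, Inr z') |z z'. (Inr z, Inr z') \<in> \<beta>}
    \<union> {(Inl x, Inr z) |x z. \<exists>y. (x, y) \<in> \<theta> \<and> (Inl y, Inr z) \<in> \<beta>}"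
  by (subst pbr_comp_no_return) (auto simp: Phi1_def)

lemma pbr_comp_Phi1_left:
  "Phi1 \<psi> \<circ>\<^sub>P \<alpha> = {(Inl x, Inl x') |x x'. (Inl x, Inl x') \<in> \<alpha>}
    \<union> {(Inl x, Inr z) |x z. \<exists>y. (Inl x, Inr y) \<in> \<alpha> \<and> (y, z) \<in> \<psi>}"
  by (subst pbr_comp_no_return) (auto simp: Phi1_def)

lemma pbr_comp_Phi1_Phi1: "Phi1 \<psi> \<circ>\<^sub>P Phi1 \<theta> = Phi1 (\<theta> O \<psi>)"
  by (subst pbr_comp_Phi1_left) (auto simp: Phi1_def)

lemma eps_hat_eq_Phi1: "eps_hat X = Phi1 (Id_on X)"
  by (auto simp: eps_hat_def Phi1_def)

lemma eps_hat_sandwich: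
  "eps_hat Y \<circ>\<^sub>P \<alpha> \<circ>\<^sub>P eps_hat X = Phi1 {(x, y). x \<in> X \<and> y \<in> Y \<and> (Inl x, Inr y) \<in> \<alpha>}"
  by (auto simp: eps_hat_eq_Phi1 pbr_comp_Phi1_right pbr_comp_Phi1_left)
     (auto simp: Phi1_def)

lemma Phi1_in_PBR: "\<theta> \<subseteq> X \<times> Y \<Longrightarrow> Phi1 \<theta> \<in> PBR X Y"
  by (auto simp: Phi1_def PBR_def)

lemma Phi1_image_eq_eps_hat_sandwich:
  "Phi1 ` Pow (X \<times> Y) = (\<lambda>\<alpha>. eps_hat Y \<circ>\<^sub>P \<alpha> \<circ>\<^sub>P eps_hat X) ` PBR X Y"
proof (intro equalityI image_subsetI)
  fix \<theta> :: "('a \<times> 'b) set" assume \<theta>: "\<theta> \<in> Pow (X \<times> Y)"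
  \<comment> \<open>The sandwich fixes \<open>Phi1 \<theta>\<close>, so \<open>Phi1 \<theta>\<close> is its own preimage.\<close>
  have "Phi1 \<theta> = eps_hat Y \<circ>\<^sub>P Phi1 \<theta> \<circ>\<^sub>P eps_hat X"
    unfolding eps_hat_sandwich
    by (rule arg_cong[of _ _ Phi1]) (use \<theta> in \<open>auto simp: Phi1_def\<close>)
  then show "Phi1 \<theta> \<in> (\<lambda>\<alpha>. eps_hat Y \<circ>\<^sub>P \<alpha> \<circ>\<^sub>P eps_hat X) ` PBR X Y"
    using \<theta> by (intro image_eqI[of _ _ "Phi1 \<theta>"] Phi1_in_PBR) auto
next
  fix \<alpha> :: "('a, 'b) pbr"
  show "eps_hat Y \<circ>\<^sub>P \<alpha> \<circ>\<^sub>P eps_hat X \<in> Phi1 ` Pow (X \<times> Y)"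
    unfolding eps_hat_sandwich by (rule imageI) auto
qed

lemma category_Phi1_B_cat: "category Phi1_B_cat"
proof
  fix X Y :: "'a set" and f assume "f \<in> Hom Phi1_B_cat X Y"
  then obtain \<theta> where \<theta>: "f = Phi1 \<theta>" "\<theta> \<subseteq> X \<times> Y"
    by (auto simp: Phi1_B_cat_def B_cat_def)
  then have "\<theta> O Id_on Y = \<theta>" "Id_on X O \<theta> = \<theta>" by auto
  then show "Cmp Phi1_B_cat (Idt Phi1_B_cat Y) f = f"
    and "Cmp Phi1_B_cat f (Idt Phi1_B_cat X) = f"
    using \<theta> by (simp_all add: Phi1_B_cat_def PB_cat_def B_cat_def pbr_comp_Phi1_Phi1)
qed (auto simp: Phi1_B_cat_def PB_cat_def B_cat_def pbr_comp_Phi1_Phi1 O_assoc)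

lemma e_subcategory_Phi1_B_cat: "e_subcategory PB_cat eps_hat Phi1_B_cat"
  using category_Phi1_B_cat
  by (auto simp: e_subcategory_def Phi1_B_cat_def PB_cat_def B_cat_def eps_hat_eq_Phi1 Phi1_in_PBR)

text \<open>
  The identity laws hold in \<open>D\<close>, whose identities are the idempotents and whose composition is
  that of \<open>C\<close>. This confines the hom-sets of every \<open>e\<close>-subcategory.
\<close>

lemma e_subcategory_sandwich:
  assumes "e_subcategory C e D" "X \<in> Obj D" "Y \<in> Obj D" "f \<in> Hom D X Y"
  shows "Cmp C (Cmp C (e Y) f) (e X) = f"
proof -
  interpret D: category D using assms(1) by (simp add: e_subcategory_def)
  have Idt: "Idt D X = e X" "Idt D Y = e Y"
    using assms by (auto simp: e_subcategory_def)
  have "Cmp C (e Y) f = Cmp D (e Y) f" "Cmp C f (e X) = Cmp D f (e X)"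
    using assms D.Idt_closed[of X] D.Idt_closed[of Y] Idt by (auto simp: e_subcategory_def)
  then show ?thesis
    using assms D.Idt_left[of X Y f] D.Idt_right[of X Y f] Idt by simp
qed

lemma maximum_e_subcategory_Phi1_B_cat: "maximum_e_subcategory PB_cat eps_hat Phi1_B_cat"
  unfolding maximum_e_subcategory_def
proof (intro conjI allI impI ballI subsetI)
  show "e_subcategory PB_cat eps_hat Phi1_B_cat" by (rule e_subcategory_Phi1_B_cat)
next
  fix D :: "('a set, ('a, 'a) pbr) cat" and X
  assume "e_subcategory PB_cat eps_hat D" "X \<in> Obj D"
  then have "X \<in> Obj PB_cat" unfolding e_subcategory_def by blast
  then show "X \<in> Obj Phi1_B_cat" by (simp add: Phi1_B_cat_def PB_cat_def B_cat_def)
next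
  fix D :: "('a set, ('a, 'a) pbr) cat" and X Y f
  assume D: "e_subcategory PB_cat eps_hat D" "X \<in> Obj D" "Y \<in> Obj D" "f \<in> Hom D X Y"
  have "f \<in> Hom PB_cat X Y" using D unfolding e_subcategory_def by blast
  then have "f \<in> PBR X Y" by (simp add: PB_cat_def)
  moreover have "f = eps_hat Y \<circ>\<^sub>P f \<circ>\<^sub>P eps_hat X"
    using e_subcategory_sandwich[OF D] by (simp add: PB_cat_def)
  ultimately have "f \<in> Phi1 ` Pow (X \<times> Y)"
    unfolding Phi1_image_eq_eps_hat_sandwich by blast
  then show "f \<in> Hom Phi1_B_cat X Y"
    by (simp add: Phi1_B_cat_def B_cat_def)
qed

theorem proposition5:
  "maximum_e_subcategory (PB_cat :: ('a set, ('a, 'a) pbr) cat) eps_hat Phi1_B_cat \<and>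
   (\<forall>(X :: 'x set) (Y :: 'y set). finite X \<longrightarrow> finite Y \<longrightarrow>
      Phi1 ` Pow (X \<times> Y) = (\<lambda>\<alpha>. eps_hat Y \<circ>\<^sub>P \<alpha> \<circ>\<^sub>P eps_hat X) ` PBR X Y)"
  by (simp add: maximum_e_subcategory_Phi1_B_cat Phi1_image_eq_eps_hat_sandwich)

end
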